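(* Let $E$ be a regular locale and let $\mu$ be a (bounded) measure on $E$, extended to all sublocales of $E$ by $\mu(X)=\inf\{\mu(V) : V \text{ open},\ X\subset V\}$. Then for all sublocales $A,B$ of $E$, $$\mu(A\cup B)=\mu(A)+\mu(B)-\mu(A\cap B).$$
   Context: A locale $E$ is given by a partially ordered set $(O(E),\subset)$, whose elements are called opens, with a least element $\emptyset$ and a greatest element $1_E$ (also written $E$), in which every family $(V_i)$ has a supremum $\bigcup_i V_i$, every pair has an infimum $U\cap V$, and $W\cap\bigcup_i V_i=\bigcup_i (W\cap V_i)$. A sublocale $X$ of $E$ is given by a map $e_X:O(E)\to O(E)$ (its projector) that is increasing, idempotent, and satisfies $U\subset e_X(U)$ and $e_X(U\cap V)=e_X(U)\cap e_X(V)$ for all $U,V\in O(E)$. For sublocales, $X\subset Y$ means $e_X(H)\supset e_Y(H)$ for all $H\in O(E)$. Ordered by inclusion, the sublocales of $E$ form a complete lattice; $\cup$ and $\cap$ of sublocales denote supremum and infimum in it. An open $U\in O(E)$ is identified with the open sublocale whose projector is $e_U(H)=$ the largest open $W$ with $W\cap U\subset H$. The closed sublocale $E-U$ has projector $H\mapsto H\cup U$. The closure $\overline X$ of a sublocale $X$ is the smallest closed sublocale containing $X$. $E$ is regular if for every open $U$, the opens $V$ with $\overline V\subset U$ have union $U$. A (bounded) measure on $E$ is a map $\mu:O(E)\to\mathbb R^+=[0,\infty)$ with $\mu(\emptyset)=0$; $U\subset V\Rightarrow\mu(U)\le\mu(V)$; $\mu(U\cup V)=\mu(U)+\mu(V)-\mu(U\cap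 V)$; and $\mu(\bigcup_i V_i)=\sup_i\mu(V_i)$ for every upward directed family $(V_i)$ of opens. *)

theory Defs
  imports Complex_Main
begin

text \<open>
  A locale is represented by its frame of opens, given as a type of class \<open>frame\<close>. The class
  \<open>complete_distrib_lattice\<close> of the library is not suitable here, since it demands complete
  distributivity.
\<close>

class frame = complete_lattice +
  assumes inf_Sup_frame: "inf W (Sup \<V>) = (SUP V\<in>\<V>. inf W V)"

lemma frame_inf_sup_distrib:
  fixes W U V :: "'a::frame"
  shows "inf W (sup U V) = sup (inf W U) (inf W V)"
  using inf_Sup_frame[of W "{U, V}"] by simp

lemma frame_sup_inf_distrib:
  fixes W U V :: "'a::frame"
  shows "sup (inf U V) W = inf (sup U W) (sup V W)"
  using distrib_imp1[OF frame_inf_sup_distrib, of W U V] by (simp add: sup.commute)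

definition projector :: "('a::frame \<Rightarrow> 'a) \<Rightarrow> bool" where
  "projector e \<longleftrightarrow>
     mono e \<and> (\<forall>U. e (e U) = e U) \<and> (\<forall>U. U \<le> e U) \<and> (\<forall>U V. e (inf U V) = inf (e U) (e V))"

lemma projectorI:
  assumes "\<And>U. e (e U) \<le> e U" "\<And>U. U \<le> e U" "\<And>U V. e (inf U V) = inf (e U) (e V)"
  shows "projector e"
proof -
  have "mono e"
    by (metis assms(3) inf.absorb_iff1 monoI)
  then show ?thesis
    unfolding projector_def using assms by (auto intro: antisym)
qed

typedef (overloaded) 'a subloc = "{e :: 'a::frame \<Rightarrow> 'a. projector e}"
  morphisms proj Abs_subloc
  by (rule exI[of _ id]) (auto intro: projectorI)

setup_lifting type_definition_subloc

lemma projector_proj: "projector (proj X)"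
  using proj[of X] by simp

lemma proj_mono: "U \<le> V \<Longrightarrow> proj X U \<le> proj X V"
  using projector_proj[of X] by (auto simp: projector_def mono_def)

lemma proj_idem: "proj X (proj X U) = proj X U"
  using projector_proj[of X] by (auto simp: projector_def)

lemma proj_ge: "U \<le> proj X U"
  using projector_proj[of X] by (auto simp: projector_def)

lemma proj_inf: "proj X (inf U V) = inf (proj X U) (proj X V)"
  using projector_proj[of X] by (auto simp: projector_def)

text \<open>Inclusion of sublocales reverses the pointwise order of projectors.\<close>

instantiation subloc :: (frame) order
begin

definition less_eq_subloc :: "'a subloc \<Rightarrow> 'a subloc \<Rightarrow> bool" where
  "X \<le> Y \<longleftrightarrow> (\<forall>H. proj Y H \<le> proj X H)"

definition less_subloc :: "'a subloc \<Rightarrow> 'a subloc \<Rightarrow> bool" where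
  "X < Y \<longleftrightarrow> X \<le> Y \<and> \<not> Y \<le> (X :: 'a subloc)"

instance
proof
  fix X Y Z :: "'a subloc"
  show "(X < Y) = (X \<le> Y \<and> \<not> Y \<le> X)" by (rule less_subloc_def)
  show "X \<le> X" by (simp add: less_eq_subloc_def)
  show "X \<le> Z" if "X \<le> Y" "Y \<le> Z"
    using that unfolding less_eq_subloc_def by (meson order_trans)
  show "X = Y" if "X \<le> Y" "Y \<le> X"
    using that unfolding less_eq_subloc_def
    by (metis antisym ext proj_inject)
qed

end

instantiation subloc :: (frame) complete_lattice
begin

lift_definition Sup_subloc :: "'a subloc set \<Rightarrow> 'a subloc" is
  "\<lambda>\<X> H. INF e\<in>\<X>. e H"
proof (rule projectorI)
  fix \<X> :: "('a \<Rightarrow> 'a) set" and U V :: 'a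
  assume "\<And>e. e \<in> \<X> \<Longrightarrow> projector e"
  then have *: "e (e U) = e U" "U \<le> e U" "e (inf U V) = inf (e U) (e V)"
    "U \<le> V \<Longrightarrow> e U \<le> e V" if "e \<in> \<X>" for e U V
    using that by (auto simp: projector_def mono_def)
  show "(INF e\<in>\<X>. e (INF e\<in>\<X>. e U)) \<le> (INF e\<in>\<X>. e U)"
    by (rule INF_mono) (metis *(1,4) INF_lower)
  show "U \<le> (INF e\<in>\<X>. e U)"
    by (rule INF_greatest) (rule *(2))
  show "(INF e\<in>\<X>. e (inf U V)) = inf (INF e\<in>\<X>. e U) (INF e\<in>\<X>. e V)"
    by (simp add: *(3) INF_inf_distrib cong: INF_cong)
qed

definition Inf_subloc :: "'a subloc set \<Rightarrow> 'a subloc" where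
  "Inf \<X> = Sup {Y :: 'a subloc. \<forall>X\<in>\<X>. Y \<le> X}"

definition sup_subloc :: "'a subloc \<Rightarrow> 'a subloc \<Rightarrow> 'a subloc" where
  "sup X Y = Sup {X, Y :: 'a subloc}"

definition inf_subloc :: "'a subloc \<Rightarrow> 'a subloc \<Rightarrow> 'a subloc" where
  "inf X Y = Inf {X, Y :: 'a subloc}"

definition bot_subloc :: "'a subloc" where "bot = Sup ({} :: 'a subloc set)"

definition top_subloc :: "'a subloc" where "top = Inf ({} :: 'a subloc set)"

instance
proof
  have upper: "X \<le> Sup \<X>" if "X \<in> \<X>" for X :: "'a subloc" and \<X>
    unfolding less_eq_subloc_def Sup_subloc.rep_eq using that by (auto intro: INF_lower)
  have least: "Sup \<X> \<le> Z" if "\<And>X. X \<in> \<X> \<Longrightarrow> X \<le> Z" for Z :: "'a subloc" and \<X>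
    using that unfolding less_eq_subloc_def Sup_subloc.rep_eq by (auto intro: INF_greatest)
  have lower: "Inf \<X> \<le> X" if "X \<in> \<X>" for X :: "'a subloc" and \<X>
    unfolding Inf_subloc_def using that by (intro least) auto
  have greatest: "Z \<le> Inf \<X>" if "\<And>X. X \<in> \<X> \<Longrightarrow> Z \<le> X" for Z :: "'a subloc" and \<X>
    unfolding Inf_subloc_def using that by (intro upper) auto
  fix X Y Z :: "'a subloc" and \<X> :: "'a subloc set"
  show "X \<in> \<X> \<Longrightarrow> X \<le> Sup \<X>" by (rule upper)
  show "(\<And>X. X \<in> \<X> \<Longrightarrow> X \<le> Z) \<Longrightarrow> Sup \<X> \<le> Z" by (rule least)
  show "X \<in> \<X> \<Longrightarrow> Inf \<X> \<le> X" by (rule lower)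
  show "(\<And>X. X \<in> \<X> \<Longrightarrow> Z \<le> X) \<Longrightarrow> Z \<le> Inf \<X>" by (rule greatest)
  show "X \<le> sup X Y" "Y \<le> sup X Y" unfolding sup_subloc_def by (auto intro: upper)
  show "X \<le> Z \<Longrightarrow> Y \<le> Z \<Longrightarrow> sup X Y \<le> Z" for X Y Z :: "'a subloc"
    unfolding sup_subloc_def by (auto intro: least)
  show "inf X Y \<le> X" "inf X Y \<le> Y" unfolding inf_subloc_def by (auto intro: lower)
  show "X \<le> Y \<Longrightarrow> X \<le> Z \<Longrightarrow> X \<le> inf Y Z"
    unfolding inf_subloc_def by (auto intro: greatest)
qed (simp_all add: bot_subloc_def top_subloc_def)

end

text \<open>
  In a frame the supremum of all \<open>W\<close> with \<open>inf W U \<le> H\<close> is itself such a \<open>W\<close>.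
\<close>

lemma inf_Sup_le:
  fixes U H :: "'a::frame"
  shows "inf (Sup {W. inf W U \<le> H}) U \<le> H"
proof -
  have "inf U (Sup {W. inf W U \<le> H}) \<le> H"
    unfolding inf_Sup_frame by (rule SUP_least) (simp add: inf.commute)
  then show ?thesis by (simp add: inf.commute)
qed

lemma le_Sup_inf_iff:
  fixes W U H :: "'a::frame"
  shows "W \<le> Sup {W. inf W U \<le> H} \<longleftrightarrow> inf W U \<le> H"
proof
  assume "W \<le> Sup {W. inf W U \<le> H}"
  then have "inf W U \<le> inf (Sup {W. inf W U \<le> H}) U"
    by (rule inf_mono) simp
  then show "inf W U \<le> H"
    using inf_Sup_le by (rule order_trans)
qed (simp add: Sup_upper)

lift_definition open_subloc :: "'a::frame \<Rightarrow> 'a subloc" is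
  "\<lambda>U H. Sup {W. inf W U \<le> H}"
proof (rule projectorI)
  fix U H K :: 'a
  show "Sup {W. inf W U \<le> Sup {W. inf W U \<le> H}} \<le> Sup {W. inf W U \<le> H}"
    by (rule Sup_least) (simp add: le_Sup_inf_iff inf.assoc)
  show "H \<le> Sup {W. inf W U \<le> H}"
    by (simp add: le_Sup_inf_iff)
  show "Sup {W. inf W U \<le> inf H K} = inf (Sup {W. inf W U \<le> H}) (Sup {W. inf W U \<le> K})"
  proof (rule antisym)
    show "Sup {W. inf W U \<le> inf H K} \<le> inf (Sup {W. inf W U \<le> H}) (Sup {W. inf W U \<le> K})"
      by (intro le_infI Sup_subset_mono) auto
    have "inf (inf (Sup {W. inf W U \<le> H}) (Sup {W. inf W U \<le> K})) U \<le> inf H K"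
    proof (rule le_infI)
      show "inf (inf (Sup {W. inf W U \<le> H}) (Sup {W. inf W U \<le> K})) U \<le> H"
        by (rule order_trans[OF inf_mono[OF inf_le1 order_refl] inf_Sup_le])
      show "inf (inf (Sup {W. inf W U \<le> H}) (Sup {W. inf W U \<le> K})) U \<le> K"
        by (rule order_trans[OF inf_mono[OF inf_le2 order_refl] inf_Sup_le])
    qed
    then show "inf (Sup {W. inf W U \<le> H}) (Sup {W. inf W U \<le> K}) \<le> Sup {W. inf W U \<le> inf H K}"
      by (simp only: le_Sup_inf_iff)
  qed
qed

lift_definition closed_subloc :: "'a::frame \<Rightarrow> 'a subloc" is
  "\<lambda>U H. sup H U"
  by (rule projectorI) (simp_all add: frame_sup_inf_distrib)

definition subloc_closure :: "'a::frame subloc \<Rightarrow> 'a subloc" where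
  "subloc_closure X = (LEAST C. C \<in> range closed_subloc \<and> X \<le> C)"

text \<open>The smallest closed sublocale containing \<open>X\<close> always exists.\<close>

lemma subloc_closure_eq: "subloc_closure X = closed_subloc (proj X bot)"
  unfolding subloc_closure_def
proof (rule Least_equality)
  show "closed_subloc (proj X bot) \<in> range closed_subloc \<and> X \<le> closed_subloc (proj X bot)"
    by (auto simp: less_eq_subloc_def closed_subloc.rep_eq proj_ge intro: proj_mono)
next
  fix C assume "C \<in> range closed_subloc \<and> X \<le> C"
  then obtain U where C: "C = closed_subloc U" and "X \<le> C" by auto
  then have "U \<le> proj X bot"
    by (metis closed_subloc.rep_eq less_eq_subloc_def sup_bot_left)
  then show "closed_subloc (proj X bot) \<le> C"
    unfolding C less_eq_subloc_def closed_subloc.rep_eq by (auto intro: le_supI2)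
qed

definition regular_frame :: "'a::frame itself \<Rightarrow> bool" where
  "regular_frame _ \<longleftrightarrow>
     (\<forall>U :: 'a. Sup {V. subloc_closure (open_subloc V) \<le> open_subloc U} = U)"

text \<open>Directed families are nonempty, so that the real supremum below is a genuine one.\<close>

definition frame_measure :: "('a::frame \<Rightarrow> real) \<Rightarrow> bool" where
  "frame_measure \<mu> \<longleftrightarrow>
     (\<forall>U. 0 \<le> \<mu> U) \<and>
     \<mu> bot = 0 \<and>
     (\<forall>U V. U \<le> V \<longrightarrow> \<mu> U \<le> \<mu> V) \<and>
     (\<forall>U V. \<mu> (sup U V) = \<mu> U + \<mu> V - \<mu> (inf U V)) \<and>
     (\<forall>\<D>. \<D> \<noteq> {} \<and> (\<forall>U\<in>\<D>. \<forall>V\<in>\<D>. \<exists>W\<in>\<D>. U \<le> W \<and> V \<le> W)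
        \<longrightarrow> \<mu> (Sup \<D>) = (SUP V\<in>\<D>. \<mu> V))"

definition outer_ext :: "('a::frame \<Rightarrow> real) \<Rightarrow> 'a subloc \<Rightarrow> real" where
  "outer_ext \<mu> X = (INF V\<in>{V. X \<le> open_subloc V}. \<mu> V)"

text \<open>
  The infimum is over a nonempty set, because the whole locale is an open sublocale, and it is
  bounded below whenever \<open>\<mu>\<close> is nonnegative.
\<close>

lemma le_open_subloc_top: "X \<le> open_subloc (top :: 'a::frame)"
  by (auto simp: less_eq_subloc_def open_subloc.rep_eq intro!: Sup_least intro: order_trans[OF _ proj_ge])

end

theory Submission
  imports Defs
begin

text \<open>
  Subadditivity, \<open>\<mu>(A \<union> B) + \<mu>(A \<inter> B) \<le> \<mu>(A) + \<mu>(B)\<close>, follows from modularity on opens, since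
  neighbourhoods \<open>U\<close> of \<open>A\<close> and \<open>V\<close> of \<open>B\<close> give neighbourhoods \<open>U \<union> V\<close> and \<open>U \<inter> V\<close>. The converse
  fails for subsets of a topological space (two disjoint nonmeasurable sets may both have full outer
  measure); it holds here because \<open>A \<inter> B\<close>, taken among sublocales, is large enough to
  carry all the mass that the neighbourhoods of \<open>A\<close> and \<open>B\<close> share. That is, every open \<open>W\<close>
  containing \<open>A \<inter> B\<close> satisfies \<open>\<mu>(W) \<ge> m\<close>, where \<open>m\<close> is the infimum of \<open>\<mu>(U \<inter> V)\<close> over the open
  \<open>U \<supseteq> A\<close> and \<open>V \<supseteq> B\<close> (lemma \<open>inf_neighbourhoods_le\<close>).

  To see this, put \<open>\<nu>(O) = inf \<mu>(O \<inter> U \<inter> V)\<close> over the same \<open>U\<close> and \<open>V\<close>. As an infimum over a downward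
  directed family this is again a measure (lemma \<open>frame_measure_concentrate\<close>), of total mass \<open>m\<close>.
  Every measure \<open>\<nu>\<close> has a sublocale \<open>S\<close> whose open neighbourhoods are exactly the opens of full
  \<open>\<nu>\<close>-mass; its projector sends \<open>U\<close> to the largest open containing \<open>U\<close> with the same
  \<open>\<nu>\<close>-measure. In a regular locale, \<open>S\<close> lies in every sublocale all of whose open
  neighbourhoods have full mass (lemma \<open>carrier_le\<close>). Both \<open>A\<close> and \<open>B\<close> are of this kind, so
  \<open>S \<subseteq> A \<inter> B \<subseteq> W\<close>, and therefore \<open>\<mu>(W) \<ge> \<nu>(W) = m\<close>.
\<close>

section \<open>Measures on a frame\<close>

definition updirected :: "'a::order set \<Rightarrow> bool" where
  "updirected \<D> \<longleftrightarrow> \<D> \<noteq> {} \<and> (\<forall>U\<in>\<D>. \<forall>V\<in>\<D>. \<exists>W\<in>\<D>. U \<le> W \<and> V \<le> W)"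

definition downdirected :: "'a::order set \<Rightarrow> bool" where
  "downdirected \<F> \<longleftrightarrow> \<F> \<noteq> {} \<and> (\<forall>U\<in>\<F>. \<forall>V\<in>\<F>. \<exists>W\<in>\<F>. W \<le> U \<and> W \<le> V)"

lemma updirectedI:
  fixes U :: "'a::semilattice_sup"
  assumes "U \<in> \<D>" "\<And>V W. V \<in> \<D> \<Longrightarrow> W \<in> \<D> \<Longrightarrow> sup V W \<in> \<D>"
  shows "updirected \<D>"
  unfolding updirected_def using assms by (blast intro: sup_ge1 sup_ge2)

lemma frame_measure_iff:
  "frame_measure \<mu> \<longleftrightarrow>
     (\<forall>U. 0 \<le> \<mu> U) \<and> \<mu> bot = 0 \<and> (\<forall>U V. U \<le> V \<longrightarrow> \<mu> U \<le> \<mu> V) \<and>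
     (\<forall>U V. \<mu> (sup U V) = \<mu> U + \<mu> V - \<mu> (inf U V)) \<and>
     (\<forall>\<D>. updirected \<D> \<longrightarrow> \<mu> (Sup \<D>) = (SUP V\<in>\<D>. \<mu> V))"
  unfolding frame_measure_def updirected_def by blast

context
  fixes \<mu> :: "'a::frame \<Rightarrow> real"
  assumes \<mu>: "frame_measure \<mu>"
begin

lemma measure_nonneg: "0 \<le> \<mu> U"
  and measure_bot: "\<mu> bot = 0"
  and measure_mono: "U \<le> V \<Longrightarrow> \<mu> U \<le> \<mu> V"
  and measure_sup: "\<mu> (sup U V) = \<mu> U + \<mu> V - \<mu> (inf U V)"
  and measure_Sup: "updirected \<D> \<Longrightarrow> \<mu> (Sup \<D>) = (SUP V\<in>\<D>. \<mu> V)"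
  using \<mu> unfolding frame_measure_iff by simp_all

lemma measure_Sup_le:
  assumes "updirected \<D>" "\<And>V. V \<in> \<D> \<Longrightarrow> \<mu> V \<le> c"
  shows "\<mu> (Sup \<D>) \<le> c"
  using assms measure_Sup[OF assms(1)] by (auto simp: updirected_def intro!: cSUP_least)

lemma measure_inf_increment:
  assumes "U \<le> U'"
  shows "\<mu> (inf U' V) - \<mu> (inf U V) \<le> \<mu> U' - \<mu> U"
proof -
  have "\<mu> (sup U (inf U' V)) = \<mu> U + \<mu> (inf U' V) - \<mu> (inf U V)"
    using assms by (simp add: measure_sup inf.absorb1 flip: inf.assoc)
  moreover have "\<mu> (sup U (inf U' V)) \<le> \<mu> U'"
    using assms by (intro measure_mono) simp
  ultimately show ?thesis by linarith
qed

lemma bdd_below_measure: "bdd_below (\<mu> ` \<F>)"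
  by (rule bdd_belowI2[of _ 0]) (rule measure_nonneg)

end

section \<open>Concentrating a measure along a downward directed family\<close>

text \<open>
  In a regular locale, when \<open>\<F>\<close> consists of the open neighbourhoods of a sublocale \<open>X\<close>, this is the
  restriction \<open>O \<mapsto> \<mu>(O \<inter> X)\<close> of the outer measure.
\<close>

definition concentrate :: "('a::frame \<Rightarrow> real) \<Rightarrow> 'a set \<Rightarrow> 'a \<Rightarrow> real" where
  "concentrate \<mu> \<F> V = (INF F\<in>\<F>. \<mu> (inf V F))"

context
  fixes \<mu> :: "'a::frame \<Rightarrow> real" and \<F> :: "'a set"
  assumes \<mu>: "frame_measure \<mu>" and \<F>: "downdirected \<F>"
begin

lemma concentrate_le: "F \<in> \<F> \<Longrightarrow> concentrate \<mu> \<F> V \<le> \<mu> (inf V F)"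
  unfolding concentrate_def
  by (rule cINF_lower) (auto intro: bdd_belowI2[of _ 0] measure_nonneg[OF \<mu>])

lemma concentrate_greatest:
  "(\<And>F. F \<in> \<F> \<Longrightarrow> c \<le> \<mu> (inf V F)) \<Longrightarrow> c \<le> concentrate \<mu> \<F> V"
  unfolding concentrate_def using \<F> by (intro cINF_greatest) (auto simp: downdirected_def)

lemma concentrate_le_measure: "concentrate \<mu> \<F> V \<le> \<mu> V"
proof -
  obtain F where "F \<in> \<F>" using \<F> by (auto simp: downdirected_def)
  then show ?thesis
    using concentrate_le measure_mono[OF \<mu>, of "inf V F" V] by (metis inf_le1 order_trans)
qed

lemma concentrate_attained:
  assumes "0 < \<epsilon>"
  shows "\<exists>F\<in>\<F>. \<mu> (inf V F) < concentrate \<mu> \<F> V + \<epsilon>"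
  using concentrate_greatest[of "concentrate \<mu> \<F> V + \<epsilon>" V] assms by force

text \<open>
  Directedness of \<open>\<F>\<close> provides one member that nearly attains two infima at the same time.
\<close>

lemma concentrate_attained2:
  assumes "0 < \<epsilon>"
  shows "\<exists>F\<in>\<F>. \<mu> (inf U F) < concentrate \<mu> \<F> U + \<epsilon> \<and> \<mu> (inf V F) < concentrate \<mu> \<F> V + \<epsilon>"
proof -
  obtain F G where "F \<in> \<F>" "G \<in> \<F>" and
    less: "\<mu> (inf U F) < concentrate \<mu> \<F> U + \<epsilon>" "\<mu> (inf V G) < concentrate \<mu> \<F> V + \<epsilon>"
    using concentrate_attained[OF assms] by metis
  then obtain K where "K \<in> \<F>" and K: "K \<le> F" "K \<le> G"
    using \<F> unfolding downdirected_def by blast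
  have "\<mu> (inf U K) \<le> \<mu> (inf U F)" "\<mu> (inf V K) \<le> \<mu> (inf V G)"
    using K by (auto intro!: measure_mono[OF \<mu>] intro: le_infI2)
  with less \<open>K \<in> \<F>\<close> show ?thesis by (intro bexI[of _ K] conjI) linarith+
qed

lemma concentrate_sup:
  "concentrate \<mu> \<F> (sup U V) = concentrate \<mu> \<F> U + concentrate \<mu> \<F> V - concentrate \<mu> \<F> (inf U V)"
proof -
  let ?\<nu> = "concentrate \<mu> \<F>"
  have modular: "\<mu> (inf (sup U V) F) = \<mu> (inf U F) + \<mu> (inf V F) - \<mu> (inf (inf U V) F)" for F
  proof -
    have "inf (sup U V) F = sup (inf U F) (inf V F)"
      by (metis frame_inf_sup_distrib inf.commute)
    moreover have "inf (inf U F) (inf V F) = inf (inf U V) F"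
      by (simp add: inf.assoc inf.left_commute)
    ultimately show ?thesis by (simp add: measure_sup[OF \<mu>])
  qed
  have le: "?\<nu> (sup U V) + ?\<nu> (inf U V) \<le> ?\<nu> U + ?\<nu> V"
  proof (rule field_le_epsilon)
    fix \<epsilon> :: real assume "0 < \<epsilon>"
    then obtain F where "F \<in> \<F>" "\<mu> (inf U F) < ?\<nu> U + \<epsilon> / 2" "\<mu> (inf V F) < ?\<nu> V + \<epsilon> / 2"
      using concentrate_attained2[of "\<epsilon> / 2"] by auto
    then show "?\<nu> (sup U V) + ?\<nu> (inf U V) \<le> ?\<nu> U + ?\<nu> V + \<epsilon>"
      using modular[of F] concentrate_le[of F "sup U V"] concentrate_le[of F "inf U V"] by linarith
  qed
  have ge: "?\<nu> U + ?\<nu> V \<le> ?\<nu> (sup U V) + ?\<nu> (inf U V)"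
  proof (rule field_le_epsilon)
    fix \<epsilon> :: real assume "0 < \<epsilon>"
    then obtain F where "F \<in> \<F>"
      "\<mu> (inf (sup U V) F) < ?\<nu> (sup U V) + \<epsilon> / 2" "\<mu> (inf (inf U V) F) < ?\<nu> (inf U V) + \<epsilon> / 2"
      using concentrate_attained2[of "\<epsilon> / 2"] by (metis half_gt_zero)
    then show "?\<nu> U + ?\<nu> V \<le> ?\<nu> (sup U V) + ?\<nu> (inf U V) + \<epsilon>"
      using modular[of F] concentrate_le[of F U] concentrate_le[of F V] by linarith
  qed
  from le ge show ?thesis by linarith
qed

lemma concentrate_mono:
  assumes "U \<le> V"
  shows "concentrate \<mu> \<F> U \<le> concentrate \<mu> \<F> V"
proof (rule concentrate_greatest)
  fix F assume "F \<in> \<F>"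
  then have "concentrate \<mu> \<F> U \<le> \<mu> (inf U F)" by (rule concentrate_le)
  also have "\<dots> \<le> \<mu> (inf V F)"
    using assms by (intro measure_mono[OF \<mu>] inf_mono) auto
  finally show "concentrate \<mu> \<F> U \<le> \<mu> (inf V F)" .
qed

text \<open>
  The infimum commutes with directed suprema because the latter converge uniformly: cutting with \<open>F\<close>
  only shrinks the difference \<open>\<mu>(V) - \<mu>(U)\<close>.
\<close>

lemma concentrate_increment:
  assumes "U \<le> V"
  shows "concentrate \<mu> \<F> V - concentrate \<mu> \<F> U \<le> \<mu> V - \<mu> U"
proof -
  have "concentrate \<mu> \<F> V - (\<mu> V - \<mu> U) \<le> concentrate \<mu> \<F> U"
  proof (rule concentrate_greatest)
    fix F assume "F \<in> \<F>"
    then show "concentrate \<mu> \<F> V - (\<mu> V - \<mu> U) \<le> \<mu> (inf U F)"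
      using concentrate_le[of F V] measure_inf_increment[OF \<mu> assms, of F] by linarith
  qed
  then show ?thesis by linarith
qed

lemma frame_measure_concentrate: "frame_measure (concentrate \<mu> \<F>)"
  unfolding frame_measure_iff
proof (intro conjI allI impI)
  let ?\<nu> = "concentrate \<mu> \<F>"
  show nonneg: "0 \<le> ?\<nu> U" for U
    by (rule concentrate_greatest) (rule measure_nonneg[OF \<mu>])
  show "?\<nu> bot = 0"
    using nonneg[of bot] concentrate_le_measure[of bot] measure_bot[OF \<mu>] by simp
  show "?\<nu> U \<le> ?\<nu> V" if "U \<le> V" for U V
    using that by (rule concentrate_mono)
  show "?\<nu> (sup U V) = ?\<nu> U + ?\<nu> V - ?\<nu> (inf U V)" for U V
    by (rule concentrate_sup)
  fix \<D> :: "'a set" assume \<D>: "updirected \<D>"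
  then have ne: "\<D> \<noteq> {}" by (simp add: updirected_def)
  have bdd: "bdd_above (?\<nu> ` \<D>)"
    by (rule bdd_aboveI2[of _ _ "?\<nu> (Sup \<D>)"]) (simp add: concentrate_mono Sup_upper)
  show "?\<nu> (Sup \<D>) = (SUP V\<in>\<D>. ?\<nu> V)"
  proof (rule antisym)
    have "\<mu> (Sup \<D>) \<le> \<mu> (Sup \<D>) - ?\<nu> (Sup \<D>) + (SUP V\<in>\<D>. ?\<nu> V)"
    proof (rule measure_Sup_le[OF \<mu> \<D>])
      fix V assume "V \<in> \<D>"
      then show "\<mu> V \<le> \<mu> (Sup \<D>) - ?\<nu> (Sup \<D>) + (SUP V\<in>\<D>. ?\<nu> V)"
        using concentrate_increment[of V "Sup \<D>"] cSUP_upper[OF _ bdd, of V] Sup_upper[of V \<D>]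
        by linarith
    qed
    then show "?\<nu> (Sup \<D>) \<le> (SUP V\<in>\<D>. ?\<nu> V)" by linarith
    show "(SUP V\<in>\<D>. ?\<nu> V) \<le> ?\<nu> (Sup \<D>)"
      using ne by (rule cSUP_least) (simp add: concentrate_mono Sup_upper)
  qed
qed

end

section \<open>The smallest sublocale of full measure\<close>

definition saturate :: "('a::frame \<Rightarrow> real) \<Rightarrow> 'a \<Rightarrow> 'a" where
  "saturate \<mu> U = Sup {V. U \<le> V \<and> \<mu> V = \<mu> U}"

context
  fixes \<mu> :: "'a::frame \<Rightarrow> real"
  assumes \<mu>: "frame_measure \<mu>"
begin

lemma saturate_ge: "U \<le> saturate \<mu> U"
  unfolding saturate_def by (rule Sup_upper) simp

text \<open>
  By modularity the opens over \<open>U\<close> of the same measure are closed under binary suprema, so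
  continuity of \<open>\<mu>\<close> applies to their supremum.
\<close>

lemma measure_saturate: "\<mu> (saturate \<mu> U) = \<mu> U"
proof (rule antisym)
  let ?\<D> = "{V. U \<le> V \<and> \<mu> V = \<mu> U}"
  have "sup V W \<in> ?\<D>" if "V \<in> ?\<D>" "W \<in> ?\<D>" for V W
  proof -
    have "\<mu> U \<le> \<mu> (inf V W)"
      using that by (intro measure_mono[OF \<mu>]) simp
    moreover have "\<mu> (inf V W) \<le> \<mu> V"
      by (rule measure_mono[OF \<mu>]) simp
    ultimately have "\<mu> (inf V W) = \<mu> U" using that by simp
    with that show ?thesis by (simp add: measure_sup[OF \<mu>] le_supI1)
  qed
  then have "updirected ?\<D>"
    by (intro updirectedI[of U]) auto
  then show "\<mu> (saturate \<mu> U) \<le> \<mu> U"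
    unfolding saturate_def by (rule measure_Sup_le[OF \<mu>]) simp
  show "\<mu> U \<le> \<mu> (saturate \<mu> U)"
    using saturate_ge by (rule measure_mono[OF \<mu>])
qed

lemma le_saturateI:
  assumes "U \<le> V" "\<mu> V \<le> \<mu> U"
  shows "V \<le> saturate \<mu> U"
  unfolding saturate_def
  using assms measure_mono[OF \<mu> assms(1)] by (intro Sup_upper) simp

lemma saturate_mono:
  assumes "U \<le> V"
  shows "saturate \<mu> U \<le> saturate \<mu> V"
proof -
  have "\<mu> U \<le> \<mu> (inf (saturate \<mu> U) V)"
    using assms saturate_ge by (intro measure_mono[OF \<mu>]) simp
  then have "\<mu> (sup (saturate \<mu> U) V) \<le> \<mu> V"
    by (simp add: measure_sup[OF \<mu>] measure_saturate)
  then have "sup (saturate \<mu> U) V \<le> saturate \<mu> V"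
    by (intro le_saturateI) auto
  then show ?thesis by simp
qed

lemma projector_saturate: "projector (saturate \<mu>)"
proof (rule projectorI)
  fix U V
  show "saturate \<mu> (saturate \<mu> U) \<le> saturate \<mu> U"
    by (rule le_saturateI) (auto simp: measure_saturate intro: order_trans saturate_ge)
  show "U \<le> saturate \<mu> U" by (rule saturate_ge)
  show "saturate \<mu> (inf U V) = inf (saturate \<mu> U) (saturate \<mu> V)"
  proof (rule antisym)
    show "saturate \<mu> (inf U V) \<le> inf (saturate \<mu> U) (saturate \<mu> V)"
      by (simp add: saturate_mono)
    have "\<mu> (inf (saturate \<mu> U) (saturate \<mu> V)) \<le> \<mu> (inf U (saturate \<mu> V))"
      using measure_inf_increment[OF \<mu> saturate_ge, of U "saturate \<mu> V"]
      by (simp add: measure_saturate)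
    also have "\<dots> \<le> \<mu> (inf U V)"
      using measure_inf_increment[OF \<mu> saturate_ge, of V U]
      by (simp add: measure_saturate inf.commute)
    finally show "inf (saturate \<mu> U) (saturate \<mu> V) \<le> saturate \<mu> (inf U V)"
      by (intro le_saturateI inf_mono saturate_ge)
  qed
qed

end

definition carrier :: "('a::frame \<Rightarrow> real) \<Rightarrow> 'a subloc" where
  "carrier \<mu> = Abs_subloc (saturate \<mu>)"

lemma proj_carrier: "frame_measure \<mu> \<Longrightarrow> proj (carrier \<mu>) = saturate \<mu>"
  unfolding carrier_def by (simp add: Abs_subloc_inverse projector_saturate)

lemma le_open_subloc_iff: "X \<le> open_subloc U \<longleftrightarrow> proj X U = top"
proof
  assume "X \<le> open_subloc U"
  then have "proj (open_subloc U) U \<le> proj X U"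
    by (simp add: less_eq_subloc_def)
  moreover have "top \<le> proj (open_subloc U) U"
    by (simp add: open_subloc.rep_eq le_Sup_inf_iff)
  ultimately show "proj X U = top"
    by (simp add: top_unique)
next
  assume top: "proj X U = top"
  show "X \<le> open_subloc U"
    unfolding less_eq_subloc_def open_subloc.rep_eq
  proof (intro allI Sup_least, clarify)
    fix H W assume "inf W U \<le> H"
    then have "inf (proj X W) (proj X U) \<le> proj X H"
      by (metis proj_inf proj_mono)
    then show "W \<le> proj X H"
      by (simp add: top order_trans[OF proj_ge])
  qed
qed

lemma measure_eq_of_carrier_le:
  assumes "frame_measure \<mu>" "carrier \<mu> \<le> open_subloc W"
  shows "\<mu> W = \<mu> top"
  using assms measure_saturate[OF assms(1), of W] by (simp add: le_open_subloc_iff proj_carrier)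

text \<open>
  The best candidate for \<open>N\<close> is the pseudocomplement of \<open>V\<close>, whose closed complement is the closure
  of \<open>V\<close>. Allowing any \<open>N\<close> makes it visible that the opens \<open>V\<close> with closure in \<open>U\<close> are directed: for
  \<open>V \<union> W\<close> intersect the two witnesses.
\<close>

lemma closure_le_open_iff:
  "subloc_closure (open_subloc V) \<le> open_subloc U \<longleftrightarrow> (\<exists>N. inf V N = bot \<and> sup U N = top)"
proof -
  let ?N = "Sup {W. inf W V \<le> bot}"
  have "subloc_closure (open_subloc V) \<le> open_subloc U \<longleftrightarrow> sup U ?N = top"
    by (simp add: subloc_closure_eq le_open_subloc_iff closed_subloc.rep_eq open_subloc.rep_eq)
  also have "\<dots> \<longleftrightarrow> (\<exists>N. inf V N = bot \<and> sup U N = top)"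
  proof
    assume "sup U ?N = top"
    moreover have "inf V ?N = bot"
      using inf_Sup_le[of V bot] by (simp add: inf.commute bot_unique)
    ultimately show "\<exists>N. inf V N = bot \<and> sup U N = top" by blast
  next
    assume "\<exists>N. inf V N = bot \<and> sup U N = top"
    then obtain N where N: "inf V N = bot" "sup U N = top" by blast
    then have "N \<le> ?N" by (intro Sup_upper) (simp add: inf.commute)
    then have "sup U N \<le> sup U ?N" by (intro sup_mono) auto
    with N show "sup U ?N = top" by (simp add: top_unique)
  qed
  finally show ?thesis .
qed

lemma regular_updirected:
  assumes "regular_frame TYPE('a::frame)"
  obtains \<D> where "updirected \<D>" "Sup \<D> = (U :: 'a)"
    "\<And>V. V \<in> \<D> \<Longrightarrow> \<exists>N. inf V N = bot \<and> sup U N = top"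
proof
  let ?\<D> = "{V. \<exists>N. inf V N = bot \<and> sup U N = top}"
  show "Sup ?\<D> = U"
    using assms by (simp add: regular_frame_def closure_le_open_iff)
  have "sup V W \<in> ?\<D>" if "V \<in> ?\<D>" "W \<in> ?\<D>" for V W
  proof -
    from that obtain N M where N: "inf V N = bot" "sup U N = top" and M: "inf W M = bot" "sup U M = top"
      by blast
    have "inf V (inf N M) = bot"
      by (metis N(1) inf.assoc inf_bot_left)
    moreover have "inf W (inf N M) = bot"
      by (metis M(1) inf.assoc inf.commute inf_bot_left)
    ultimately have "inf (sup V W) (inf N M) = bot"
      by (metis frame_inf_sup_distrib inf.commute sup_bot_left)
    moreover have "sup U (inf N M) = top"
      by (metis N(2) M(2) frame_sup_inf_distrib inf_top_left sup.commute)
    ultimately show ?thesis by blast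
  qed
  moreover have "bot \<in> ?\<D>" by (auto intro: exI[of _ top])
  ultimately show "updirected ?\<D>"
    by (intro updirectedI[of bot])
qed auto

text \<open>
  It has to be shown that \<open>U = e\<^sub>A(H)\<close> has no more measure than \<open>H\<close>. If \<open>N\<close> is disjoint from \<open>V\<close> and
  covers with \<open>U\<close>, then \<open>H \<union> N\<close> contains \<open>A\<close> and so has full mass; all the mass of \<open>V\<close> then
  lies in \<open>V \<inter> (H \<union> N) = V \<inter> H\<close>. By regularity \<open>U\<close> is a directed union of such \<open>V\<close>.
\<close>

lemma carrier_le:
  fixes \<mu> :: "'a::frame \<Rightarrow> real"
  assumes reg: "regular_frame TYPE('a)" and \<mu>: "frame_measure \<mu>"
    and full: "\<And>U. A \<le> open_subloc U \<Longrightarrow> \<mu> U = \<mu> top"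
  shows "carrier \<mu> \<le> A"
  unfolding less_eq_subloc_def proj_carrier[OF \<mu>]
proof
  fix H
  let ?U = "proj A H"
  obtain \<D> where \<D>: "updirected \<D>" "Sup \<D> = ?U"
    and apart: "\<And>V. V \<in> \<D> \<Longrightarrow> \<exists>N. inf V N = bot \<and> sup ?U N = top"
    using regular_updirected[OF reg] by metis
  have "\<mu> (Sup \<D>) \<le> \<mu> H"
  proof (rule measure_Sup_le[OF \<mu> \<D>(1)])
    fix V assume "V \<in> \<D>"
    then obtain N where N: "inf V N = bot" "sup ?U N = top"
      using apart by blast
    have "sup ?U N \<le> proj A (sup H N)"
      by (intro le_supI proj_mono order_trans[OF _ proj_ge]) auto
    then have "A \<le> open_subloc (sup H N)"
      using N(2) by (simp add: le_open_subloc_iff top_unique)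
    then have "\<mu> (sup H N) = \<mu> top" by (rule full)
    moreover have "\<mu> (sup V (sup H N)) \<le> \<mu> top"
      by (rule measure_mono[OF \<mu>]) simp
    ultimately have "\<mu> V \<le> \<mu> (inf V (sup H N))"
      by (simp add: measure_sup[OF \<mu>, of V])
    also have "\<dots> = \<mu> (inf V H)"
      by (simp add: frame_inf_sup_distrib N(1))
    also have "\<dots> \<le> \<mu> H"
      by (rule measure_mono[OF \<mu>]) simp
    finally show "\<mu> V \<le> \<mu> H" .
  qed
  then show "?U \<le> saturate \<mu> H"
    unfolding \<D>(2) by (intro le_saturateI[OF \<mu>] proj_ge)
qed

section \<open>Modularity of the outer measure\<close>

lemma open_subloc_mono: "X \<le> open_subloc U \<Longrightarrow> U \<le> V \<Longrightarrow> X \<le> open_subloc V"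
  unfolding le_open_subloc_iff by (metis proj_mono top_unique)

lemma le_open_subloc_inf:
  "X \<le> open_subloc U \<Longrightarrow> X \<le> open_subloc V \<Longrightarrow> X \<le> open_subloc (inf U V)"
  by (simp add: le_open_subloc_iff proj_inf)

context
  fixes \<mu> :: "'a::frame \<Rightarrow> real"
  assumes \<mu>: "frame_measure \<mu>"
begin

lemma outer_ext_le: "X \<le> open_subloc V \<Longrightarrow> outer_ext \<mu> X \<le> \<mu> V"
  unfolding outer_ext_def by (rule cINF_lower[OF bdd_below_measure[OF \<mu>]]) simp

lemma outer_ext_greatest:
  "(\<And>V. X \<le> open_subloc V \<Longrightarrow> c \<le> \<mu> V) \<Longrightarrow> c \<le> outer_ext \<mu> X"
  unfolding outer_ext_def using le_open_subloc_top[of X] by (intro cINF_greatest) auto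

lemma outer_ext_sup_inf_le:
  "outer_ext \<mu> (sup A B) + outer_ext \<mu> (inf A B) \<le> outer_ext \<mu> A + outer_ext \<mu> B"
proof -
  have UV: "outer_ext \<mu> (sup A B) + outer_ext \<mu> (inf A B) \<le> \<mu> U + \<mu> V"
    if U: "A \<le> open_subloc U" and V: "B \<le> open_subloc V" for U V
  proof -
    have "sup A B \<le> open_subloc (sup U V)"
      using open_subloc_mono[OF U, of "sup U V"] open_subloc_mono[OF V, of "sup U V"] by simp
    moreover have "inf A B \<le> open_subloc (inf U V)"
      using U V by (intro le_open_subloc_inf) (auto intro: le_infI1 le_infI2)
    ultimately show ?thesis
      using outer_ext_le[of "sup A B" "sup U V"] outer_ext_le[of "inf A B" "inf U V"]
        measure_sup[OF \<mu>, of U V] by linarith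
  qed
  have "outer_ext \<mu> (sup A B) + outer_ext \<mu> (inf A B) - \<mu> V \<le> outer_ext \<mu> A"
    if "B \<le> open_subloc V" for V
    using UV[OF _ that] by (intro outer_ext_greatest) (simp add: algebra_simps)
  then have "outer_ext \<mu> (sup A B) + outer_ext \<mu> (inf A B) - outer_ext \<mu> A \<le> outer_ext \<mu> B"
    by (intro outer_ext_greatest) (simp add: algebra_simps)
  then show ?thesis by linarith
qed

text \<open>
  Concentrating \<open>\<mu>\<close> along the opens \<open>U \<inter> V\<close> yields a measure for which \<open>A\<close> and \<open>B\<close> both have
  full outer mass, since cutting a member of this family by another neighbourhood of \<open>A\<close> or of \<open>B\<close>
  gives a member again. The carrier of that measure is therefore a sublocale of \<open>A \<inter> B\<close>.
\<close>

lemma inf_neighbourhoods_le: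
  assumes reg: "regular_frame TYPE('a)"
    and W: "inf A B \<le> open_subloc W"
    and c: "\<And>U V. A \<le> open_subloc U \<Longrightarrow> B \<le> open_subloc V \<Longrightarrow> c \<le> \<mu> (inf U V)"
  shows "c \<le> \<mu> W"
proof -
  define \<F> where "\<F> = {inf U V |U V. A \<le> open_subloc U \<and> B \<le> open_subloc V}"
  have \<F>I: "inf U V \<in> \<F>" if "A \<le> open_subloc U" "B \<le> open_subloc V" for U V
    using that unfolding \<F>_def by blast
  have \<F>: "downdirected \<F>"
    unfolding downdirected_def
  proof (intro conjI ballI)
    show "\<F> \<noteq> {}" using \<F>I[OF le_open_subloc_top le_open_subloc_top] by blast
    fix F G assume "F \<in> \<F>" "G \<in> \<F>"
    then obtain U V U' V' where FG: "F = inf U V" "G = inf U' V'"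
      and "A \<le> open_subloc U" "B \<le> open_subloc V" "A \<le> open_subloc U'" "B \<le> open_subloc V'"
      unfolding \<F>_def by blast
    then have "inf (inf U U') (inf V V') \<in> \<F>"
      by (intro \<F>I le_open_subloc_inf)
    moreover have "inf (inf U U') (inf V V') \<le> F" "inf (inf U U') (inf V V') \<le> G"
      unfolding FG by (auto intro: le_infI1 le_infI2)
    ultimately show "\<exists>K\<in>\<F>. K \<le> F \<and> K \<le> G" by blast
  qed
  define \<nu> where "\<nu> = concentrate \<mu> \<F>"
  have \<nu>: "frame_measure \<nu>"
    unfolding \<nu>_def by (rule frame_measure_concentrate[OF \<mu> \<F>])
  have full: "\<nu> T = \<nu> top" if T: "\<And>F. F \<in> \<F> \<Longrightarrow> inf T F \<in> \<F>" for T
  proof (rule antisym)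
    show "\<nu> T \<le> \<nu> top" by (rule measure_mono[OF \<nu>]) simp
    show "\<nu> top \<le> \<nu> T"
      unfolding \<nu>_def
    proof (rule concentrate_greatest[OF \<mu> \<F>])
      fix F assume "F \<in> \<F>"
      then show "concentrate \<mu> \<F> top \<le> \<mu> (inf T F)"
        using concentrate_le[OF \<mu> \<F> T, of F top] by simp
    qed
  qed
  have "carrier \<nu> \<le> A"
  proof (intro carrier_le[OF reg \<nu>] full)
    fix U F assume U: "A \<le> open_subloc U" and "F \<in> \<F>"
    then obtain U' V' where F: "F = inf U' V'" "A \<le> open_subloc U'" "B \<le> open_subloc V'"
      unfolding \<F>_def by blast
    with U have "inf (inf U U') V' \<in> \<F>" by (intro \<F>I le_open_subloc_inf)
    then show "inf U F \<in> \<F>" by (simp add: F inf.assoc)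
  qed
  moreover have "carrier \<nu> \<le> B"
  proof (intro carrier_le[OF reg \<nu>] full)
    fix V F assume V: "B \<le> open_subloc V" and "F \<in> \<F>"
    then obtain U' V' where F: "F = inf U' V'" "A \<le> open_subloc U'" "B \<le> open_subloc V'"
      unfolding \<F>_def by blast
    with V have "inf U' (inf V V') \<in> \<F>" by (intro \<F>I le_open_subloc_inf)
    then show "inf V F \<in> \<F>" by (simp add: F inf.left_commute)
  qed
  ultimately have "carrier \<nu> \<le> open_subloc W"
    using W by (meson le_inf_iff order_trans)
  then have "\<nu> top = \<nu> W"
    by (simp add: measure_eq_of_carrier_le[OF \<nu>])
  moreover have "c \<le> \<nu> top"
    unfolding \<nu>_def by (rule concentrate_greatest[OF \<mu> \<F>]) (auto simp: \<F>_def c)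
  moreover have "\<nu> W \<le> \<mu> W"
    unfolding \<nu>_def by (rule concentrate_le_measure[OF \<mu> \<F>])
  ultimately show ?thesis by linarith
qed

lemma outer_ext_le_sup_inf:
  assumes reg: "regular_frame TYPE('a)"
  shows "outer_ext \<mu> A + outer_ext \<mu> B \<le> outer_ext \<mu> (sup A B) + outer_ext \<mu> (inf A B)"
proof -
  have TW: "outer_ext \<mu> A + outer_ext \<mu> B - \<mu> T \<le> \<mu> W"
    if T: "sup A B \<le> open_subloc T" and W: "inf A B \<le> open_subloc W" for T W
  proof (rule inf_neighbourhoods_le[OF reg W])
    fix U V assume "A \<le> open_subloc U" "B \<le> open_subloc V"
    \<comment> \<open>Cutting \<open>U\<close> and \<open>V\<close> down to \<open>T\<close> bounds the measure of their union by that of \<open>T\<close>.\<close>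
    with T have "A \<le> open_subloc (inf U T)" "B \<le> open_subloc (inf V T)"
      by (auto intro: le_open_subloc_inf)
    then have "outer_ext \<mu> A + outer_ext \<mu> B \<le> \<mu> (inf U T) + \<mu> (inf V T)"
      by (intro add_mono outer_ext_le)
    also have "\<dots> = \<mu> (sup (inf U T) (inf V T)) + \<mu> (inf (inf U T) (inf V T))"
      by (simp add: measure_sup[OF \<mu>])
    also have "\<dots> \<le> \<mu> T + \<mu> (inf U V)"
      by (intro add_mono measure_mono[OF \<mu>]) (auto intro: le_infI1 le_infI2)
    finally show "outer_ext \<mu> A + outer_ext \<mu> B - \<mu> T \<le> \<mu> (inf U V)" by linarith
  qed
  have "outer_ext \<mu> A + outer_ext \<mu> B - \<mu> T \<le> outer_ext \<mu> (inf A B)"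
    if "sup A B \<le> open_subloc T" for T
    using TW[OF that] by (rule outer_ext_greatest)
  then have "outer_ext \<mu> A + outer_ext \<mu> B - outer_ext \<mu> (inf A B) \<le> outer_ext \<mu> (sup A B)"
    by (intro outer_ext_greatest) (simp add: algebra_simps)
  then show ?thesis by linarith
qed

end

theorem mainTheorem1:
  fixes \<mu> :: "'a::frame \<Rightarrow> real" and A B :: "'a subloc"
  assumes "regular_frame TYPE('a)"
    and "frame_measure \<mu>"
  shows "outer_ext \<mu> (sup A B) = outer_ext \<mu> A + outer_ext \<mu> B - outer_ext \<mu> (inf A B)"
  using outer_ext_sup_inf_le[OF assms(2), of A B] outer_ext_le_sup_inf[OF assms(2,1), of A B]
  by linarith

end
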